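(* Assume that $S\colon U\to Y$ is Fréchet differentiable and let $z\in Y$. Then, for any minimizer $\bar u\in U$ of $\mathcal E^z$ over $U$ that satisfies $S(\bar u)=z$, it holds that $g(\bar u(x))=\min_{v\in\mathcal M}g(v)$ for almost every $x\in\Omega$. In particular, if in addition $\bar u(x)\in\mathcal M$ for almost every $x\in\Omega$, then $c(\bar u(x))=\min_{v\in\mathcal M}c(v)$ for almost every $x\in\Omega$.
   Context: $\Omega\subset\mathbb R^n$ is a bounded open domain, $m\ge 2$, $U=L^2(\Omega;\mathbb R^m)$, $Y$ is a (real) Hilbert space, and $S\colon U\to Y$ is a (possibly nonlinear) operator. $\mathcal M\subset\mathbb R^m$ is a (nonempty) finite set, $\alpha>0$, $c\colon\mathbb R^m\to\mathbb R$ is non-negative, strictly convex, and lower semi-continuous, and $g=(\alpha c+\delta_{\mathcal M})^{**}$ (biconjugate, i.e. convex envelope), where $\delta_{\mathcal M}$ is $0$ on $\mathcal M$ and $\infty$ elsewhere. For $z\in Y$, $\mathcal E^z(u)=\frac12\|S(u)-z\|_Y^2+\int_\Omega g(u(x))\,\mathrm dx$, $u\in U$. *)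

theory Defs
  imports "HOL-Analysis.Analysis"
begin

text \<open>
  Elements of \<open>L\<^sup>2(\<Omega>; F)\<close> are represented by square-integrable functions; only their values on
  \<open>\<Omega>\<close> matter, and only up to null sets. The function \<open>L2_norm\<close> is a seminorm on representatives,
  so an operator on \<open>L\<^sup>2\<close> is a function on representatives that satisfies \<open>respects_ae\<close>.
\<close>

definition L2 :: "'a::euclidean_space set \<Rightarrow> ('a \<Rightarrow> 'b::euclidean_space) set" where
  "L2 \<Omega> = {u. u \<in> borel_measurable (lebesgue_on \<Omega>) \<and>
              integrable (lebesgue_on \<Omega>) (\<lambda>x. (norm (u x))\<^sup>2)}"

definition L2_norm :: "'a::euclidean_space set \<Rightarrow> ('a \<Rightarrow> 'b::euclidean_space) \<Rightarrow> real" where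
  "L2_norm \<Omega> u = sqrt (\<integral>x. (norm (u x))\<^sup>2 \<partial>lebesgue_on \<Omega>)"

definition respects_ae ::
  "'a::euclidean_space set \<Rightarrow> (('a \<Rightarrow> 'b::euclidean_space) \<Rightarrow> 'y) \<Rightarrow> bool" where
  "respects_ae \<Omega> S \<longleftrightarrow>
     (\<forall>u\<in>L2 \<Omega>. \<forall>v\<in>L2 \<Omega>. (AE x in lebesgue_on \<Omega>. u x = v x) \<longrightarrow> S u = S v)"

text \<open>
  The norm bound makes a bounded linear operator respect almost-everywhere equality.
\<close>

definition L2_bounded_linear ::
  "'a::euclidean_space set \<Rightarrow> (('a \<Rightarrow> 'b::euclidean_space) \<Rightarrow> 'y::real_normed_vector) \<Rightarrow> bool" where
  "L2_bounded_linear \<Omega> D \<longleftrightarrow>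
     (\<forall>h\<in>L2 \<Omega>. \<forall>k\<in>L2 \<Omega>. D (\<lambda>x. h x + k x) = D h + D k) \<and>
     (\<forall>h\<in>L2 \<Omega>. \<forall>r::real. D (\<lambda>x. r *\<^sub>R h x) = r *\<^sub>R D h) \<and>
     (\<exists>K. \<forall>h\<in>L2 \<Omega>. norm (D h) \<le> K * L2_norm \<Omega> h)"

text \<open>
  Same form as \<open>has_derivative_at_alt\<close>, with the \<open>L\<^sup>2\<close> seminorm in place of the norm of the domain.
\<close>

definition L2_has_frechet_derivative ::
  "'a::euclidean_space set \<Rightarrow> (('a \<Rightarrow> 'b::euclidean_space) \<Rightarrow> 'y::real_normed_vector) \<Rightarrow>
   (('a \<Rightarrow> 'b) \<Rightarrow> 'y) \<Rightarrow> ('a \<Rightarrow> 'b) \<Rightarrow> bool" where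
  "L2_has_frechet_derivative \<Omega> S D u \<longleftrightarrow>
     L2_bounded_linear \<Omega> D \<and>
     (\<forall>e>0. \<exists>d>0. \<forall>h\<in>L2 \<Omega>. L2_norm \<Omega> h < d \<longrightarrow>
        norm (S (\<lambda>x. u x + h x) - S u - D h) \<le> e * L2_norm \<Omega> h)"

definition L2_frechet_differentiable ::
  "'a::euclidean_space set \<Rightarrow> (('a \<Rightarrow> 'b::euclidean_space) \<Rightarrow> 'y::real_normed_vector) \<Rightarrow> bool" where
  "L2_frechet_differentiable \<Omega> S \<longleftrightarrow> (\<forall>u\<in>L2 \<Omega>. \<exists>D. L2_has_frechet_derivative \<Omega> S D u)"

definition strictly_convex :: "('b::real_vector \<Rightarrow> real) \<Rightarrow> bool" where
  "strictly_convex c \<longleftrightarrow>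
     (\<forall>x y t. x \<noteq> y \<longrightarrow> 0 < t \<longrightarrow> t < 1 \<longrightarrow>
        c ((1 - t) *\<^sub>R x + t *\<^sub>R y) < (1 - t) * c x + t * c y)"

definition lower_semicontinuous :: "('b::topological_space \<Rightarrow> real) \<Rightarrow> bool" where
  "lower_semicontinuous c \<longleftrightarrow> (\<forall>x. \<forall>a < c x. \<forall>\<^sub>F y in nhds x. a < c y)"

definition ext_indicator :: "'b set \<Rightarrow> 'b \<Rightarrow> ereal" where
  "ext_indicator M v = (if v \<in> M then 0 else \<infinity>)"

definition fenchel_conjugate :: "('b::real_inner \<Rightarrow> ereal) \<Rightarrow> 'b \<Rightarrow> ereal" where
  "fenchel_conjugate f p = (SUP v. ereal (p \<bullet> v) - f v)"

definition multibang_penalty :: "real \<Rightarrow> ('b::real_inner \<Rightarrow> real) \<Rightarrow> 'b set \<Rightarrow> 'b \<Rightarrow> ereal" where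
  "multibang_penalty \<alpha> c M =
     fenchel_conjugate (fenchel_conjugate (\<lambda>v. ereal (\<alpha> * c v) + ext_indicator M v))"

text \<open>
  The integral of the extended-valued penalty is taken in \<open>[0, \<infinity>]\<close>. For \<open>\<alpha> * c\<close> non-negative the
  penalty is non-negative (the zero function is an affine minorant), so \<open>e2ennreal\<close> does not
  truncate it.
\<close>

definition objective ::
  "'a::euclidean_space set \<Rightarrow> (('a \<Rightarrow> 'b::euclidean_space) \<Rightarrow> 'y::real_normed_vector) \<Rightarrow>
   ('b \<Rightarrow> ereal) \<Rightarrow> 'y \<Rightarrow> ('a \<Rightarrow> 'b) \<Rightarrow> ennreal" where
  "objective \<Omega> S g z u =
     ennreal (1 / 2 * (norm (S u - z))\<^sup>2) + (\<integral>\<^sup>+x. e2ennreal (g (u x)) \<partial>lebesgue_on \<Omega>)"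

end

theory Submission
  imports Defs
begin

text \<open>
  Let \<open>\<mu>\<close> be the minimum of \<open>\<alpha> * c\<close> on \<open>M\<close>, attained at \<open>w \<in> M\<close>. The constant \<open>\<mu>\<close> is an affine minorant of
  \<open>\<alpha> * c + \<delta>\<^sub>M\<close>, so the biconjugate \<open>g\<close> satisfies \<open>\<mu> \<le> g\<close> everywhere, with equality at \<open>w\<close>. Thus
  \<open>\<mu>\<close> is also the minimum of \<open>g\<close> on \<open>M\<close>.
  
  Move from the minimizer \<open>u\<close> towards the constant control \<open>w\<close>. Because \<open>S u = z\<close> and \<open>S\<close> is
  differentiable at \<open>u\<close>, the residual at \<open>u + t (w - u)\<close> is \<open>O(t)\<close>, so the tracking term, which is
  quadratic in the residual, rises only by \<open>O(t\<^sup>2)\<close>. By convexity of \<open>g\<close> the penalty term falls by at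
  least \<open>t * (\<integral> g(u) - \<mu>)\<close>. Minimality forces the linear gain to be non-positive
  (\<open>le_if_linear_gain_le_quadratic\<close>), and since \<open>g(u) \<ge> \<mu>\<close> pointwise this means \<open>g(u) = \<mu>\<close> almost
  everywhere (\<open>exact_minimizer_attains_penalty_minimum\<close>). The integrals are finite because \<open>\<Omega>\<close> has
  finite measure, so that the constant \<open>w\<close> is a competitor of finite cost.
  
  For the second claim, convexity of \<open>c\<close> gives \<open>g = \<alpha> * c\<close> on \<open>M\<close>
  (\<open>multibang_penalty_eq_on_set\<close>), so a minimum of \<open>g\<close> attained in \<open>M\<close> is a minimum of \<open>c\<close> on \<open>M\<close>.
\<close>

section \<open>The penalty as an envelope of affine functions\<close>

lemma fenchel_conjugate_on_finite_set:
  fixes f :: "'b::real_inner \<Rightarrow> real"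
  assumes "finite M" "M \<noteq> {}"
  shows "fenchel_conjugate (\<lambda>v. ereal (f v) + ext_indicator M v) p
       = ereal (Max ((\<lambda>v. p \<bullet> v - f v) ` M))"
  unfolding fenchel_conjugate_def
proof (rule antisym)
  show "(SUP v. ereal (p \<bullet> v) - (ereal (f v) + ext_indicator M v))
        \<le> ereal (Max ((\<lambda>v. p \<bullet> v - f v) ` M))"
    using assms by (intro SUP_least) (auto simp: ext_indicator_def)
  have "Max ((\<lambda>v. p \<bullet> v - f v) ` M) \<in> (\<lambda>v. p \<bullet> v - f v) ` M"
    using assms by (intro Max_in) auto
  then obtain w where w: "w \<in> M" "Max ((\<lambda>v. p \<bullet> v - f v) ` M) = p \<bullet> w - f w"
    by auto
  show "ereal (Max ((\<lambda>v. p \<bullet> v - f v) ` M))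
        \<le> (SUP v. ereal (p \<bullet> v) - (ereal (f v) + ext_indicator M v))"
    by (rule SUP_upper2[of w]) (use w in \<open>auto simp: ext_indicator_def\<close>)
qed

text \<open>
  Since \<open>M\<close> is finite and non-empty, the inner conjugate is real-valued. The penalty is therefore a
  supremum of real affine functions, from which its measurability and convexity follow.
\<close>
lemma multibang_penalty_eq_SUP:
  assumes "finite M" "M \<noteq> {}"
  shows "multibang_penalty \<alpha> c M v
       = (SUP p. ereal (p \<bullet> v - Max ((\<lambda>w. p \<bullet> w - \<alpha> * c w) ` M)))"
  unfolding multibang_penalty_def fenchel_conjugate_on_finite_set[OF assms]
  unfolding fenchel_conjugate_def by (simp add: inner_commute)

text \<open>
  The supremum is over uncountably many slopes, so measurability is obtained from lower
  semicontinuity: the superlevel sets are unions of open half-spaces.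
\<close>
lemma borel_measurable_SUP_affine:
  fixes r :: "'b::euclidean_space \<Rightarrow> real"
  shows "(\<lambda>v. SUP p. ereal (p \<bullet> v - r p)) \<in> borel_measurable borel"
proof (rule borel_measurableI_greater)
  fix a :: ereal
  have "open {v. a < ereal (p \<bullet> v - r p)}" for p
    by (intro open_Collect_less continuous_intros)
  then have "open (\<Union>p. {v. a < ereal (p \<bullet> v - r p)})" by blast
  also have "(\<Union>p. {v. a < ereal (p \<bullet> v - r p)}) = {v. a < (SUP p. ereal (p \<bullet> v - r p))}"
    by (auto simp: less_SUP_iff)
  finally show "{v \<in> space borel. a < (SUP p. ereal (p \<bullet> v - r p))} \<in> sets borel"
    by simp
qed

lemma SUP_affine_convex:
  fixes r :: "'b::real_inner \<Rightarrow> real" and v w :: 'b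
  defines "G \<equiv> \<lambda>v. SUP p. ereal (p \<bullet> v - r p)"
  assumes "0 \<le> t" "t \<le> 1"
  shows "G ((1 - t) *\<^sub>R v + t *\<^sub>R w) \<le> ereal (1 - t) * G v + ereal t * G w"
  unfolding G_def
proof (rule SUP_least)
  fix p
  let ?a = "\<lambda>v. p \<bullet> v - r p"
  have "ereal (?a ((1 - t) *\<^sub>R v + t *\<^sub>R w)) = ereal (1 - t) * ereal (?a v) + ereal t * ereal (?a w)"
    by (simp add: inner_add_right algebra_simps)
  also have "\<dots> \<le> ereal (1 - t) * (SUP p. ereal (p \<bullet> v - r p)) + ereal t * (SUP p. ereal (p \<bullet> w - r p))"
    using assms by (intro add_mono ereal_mult_left_mono SUP_upper) auto
  finally show "ereal (?a ((1 - t) *\<^sub>R v + t *\<^sub>R w))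
    \<le> ereal (1 - t) * (SUP p. ereal (p \<bullet> v - r p)) + ereal t * (SUP p. ereal (p \<bullet> w - r p))" .
qed

text \<open>
  The slope \<open>0\<close> in the envelope yields the constant minorant.
\<close>
lemma multibang_penalty_ge_Min:
  assumes "finite M" "M \<noteq> {}"
  shows "ereal (Min ((\<lambda>w. \<alpha> * c w) ` M)) \<le> multibang_penalty \<alpha> c M v"
proof -
  have "Max ((\<lambda>w. 0 \<bullet> w - \<alpha> * c w) ` M) \<in> (\<lambda>w. 0 \<bullet> w - \<alpha> * c w) ` M"
    using assms by (intro Max_in) auto
  then obtain w where w: "w \<in> M" "Max ((\<lambda>w. 0 \<bullet> w - \<alpha> * c w) ` M) = - (\<alpha> * c w)"
    by auto
  show ?thesis
    unfolding multibang_penalty_eq_SUP[OF assms]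
    by (rule SUP_upper2[of 0]) (use w assms in \<open>auto intro: Min_le\<close>)
qed

lemma multibang_penalty_le:
  assumes "finite M" "v \<in> M"
  shows "multibang_penalty \<alpha> c M v \<le> ereal (\<alpha> * c v)"
proof -
  have ne: "M \<noteq> {}" using assms by auto
  have "p \<bullet> v - \<alpha> * c v \<le> Max ((\<lambda>w. p \<bullet> w - \<alpha> * c w) ` M)" for p
    using assms by (intro Max_ge) auto
  then show ?thesis
    unfolding multibang_penalty_eq_SUP[OF assms(1) ne]
    by (intro SUP_least) (simp add: algebra_simps)
qed

lemma multibang_penalty_at_Min:
  assumes "finite M" "w \<in> M" "\<alpha> * c w = Min ((\<lambda>w. \<alpha> * c w) ` M)"
  shows "multibang_penalty \<alpha> c M w = ereal (Min ((\<lambda>w. \<alpha> * c w) ` M))"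
  using multibang_penalty_le[OF assms(1,2), of \<alpha> c]
    multibang_penalty_ge_Min[of M \<alpha> c w] assms by (metis antisym empty_iff)

lemma strictly_convex_imp_convex_on:
  assumes "strictly_convex c"
  shows "convex_on UNIV c"
proof (rule convex_onI)
  fix t :: real and x y
  assume "0 < t" "t < 1"
  then show "c ((1 - t) *\<^sub>R x + t *\<^sub>R y) \<le> (1 - t) * c x + t * c y"
    using assms unfolding strictly_convex_def
    by (cases "x = y") (auto simp: algebra_simps less_imp_le scaleR_left_distrib[symmetric])
qed simp

text \<open>
  A point \<open>(v, s)\<close> strictly below the graph of the convex function lies outside the convex hull of
  the finitely many graph points over \<open>M\<close>, because this hull is contained in the epigraph. The hull is
  compact, so a hyperplane separates it strictly from \<open>(v, s)\<close>. That hyperplane is not vertical, since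
  \<open>v\<close> itself belongs to \<open>M\<close>, and it is the graph of an affine minorant of the function on \<open>M\<close> that
  exceeds \<open>s\<close> at \<open>v\<close>.
\<close>
lemma multibang_penalty_eq_on_set:
  fixes c :: "'b::euclidean_space \<Rightarrow> real"
  assumes "finite M" "v \<in> M" and conv: "convex_on UNIV (\<lambda>w. \<alpha> * c w)"
  shows "multibang_penalty \<alpha> c M v = ereal (\<alpha> * c v)"
proof (rule antisym)
  let ?f = "\<lambda>w. \<alpha> * c w"
  have ne: "M \<noteq> {}" using assms by auto
  show "ereal (?f v) \<le> multibang_penalty \<alpha> c M v"
  proof (rule ereal_le_real)
    fix s :: real
    assume s: "multibang_penalty \<alpha> c M v \<le> ereal s"
    show "ereal (?f v) \<le> ereal s"
    proof (rule ccontr)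
      assume "\<not> ?thesis"
      then have less: "s < ?f v" by simp
      let ?C = "convex hull ((\<lambda>w. (w, ?f w)) ` M)"
      have "?C \<subseteq> epigraph UNIV ?f"
        using conv by (intro hull_minimal) (auto simp: convex_epigraph mem_epigraph)
      then have "(v, s) \<notin> ?C" using less by (auto simp: epigraph_def)
      moreover have "closed ?C" "convex ?C"
        using assms by (auto intro: compact_imp_closed finite_imp_compact_convex_hull)
      ultimately obtain a b where ab: "a \<bullet> (v, s) < b" "\<And>y. y \<in> ?C \<Longrightarrow> b < a \<bullet> y"
        using separating_hyperplane_closed_point[of ?C "(v, s)"] by blast
      obtain q k where a: "a = (q, k)" by (cases a)
      have M: "b < q \<bullet> w + k * ?f w" if "w \<in> M" for w
        using ab(2)[of "(w, ?f w)"] that hull_inc[of "(w, ?f w)" "(\<lambda>w. (w, ?f w)) ` M"] by (auto simp: a)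
      have v: "q \<bullet> v + k * s < b" using ab(1) by (simp add: a)
      \<comment> \<open>The graph point over \<open>v\<close> lies directly above \<open>(v, s)\<close>, hence the normal points upwards.\<close>
      have "k * s < k * ?f v" using M[OF assms(2)] v by linarith
      then have k: "k > 0" using less
        by (smt (verit) mult_left_mono_neg)
      define p where "p = - (q /\<^sub>R k)"
      have pM: "p \<bullet> w - ?f w < - b / k" if "w \<in> M" for w
      proof -
        have "b / k < (q \<bullet> w + k * ?f w) / k"
          using M[OF that] k by (rule divide_strict_right_mono)
        also have "\<dots> = ?f w - p \<bullet> w" using k by (simp add: p_def field_simps)
        finally show ?thesis by simp
      qed
      have "Max ((\<lambda>w. p \<bullet> w - ?f w) ` M) < - b / k"
        using pM assms ne by (subst Max_less_iff) auto
      moreover have "s - p \<bullet> v < b / k"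
      proof -
        have "s - p \<bullet> v = (q \<bullet> v + k * s) / k" using k by (simp add: p_def field_simps)
        also have "\<dots> < b / k" using v k by (rule divide_strict_right_mono)
        finally show ?thesis .
      qed
      ultimately have "s < p \<bullet> v - Max ((\<lambda>w. p \<bullet> w - ?f w) ` M)" by simp
      also have "ereal \<dots> \<le> multibang_penalty \<alpha> c M v"
        unfolding multibang_penalty_eq_SUP[OF assms(1) ne] by (rule SUP_upper) simp
      finally show False using s by simp
    qed
  qed
qed (rule multibang_penalty_le[OF assms(1,2)])

section \<open>Square-integrable functions and the linear growth of the residual\<close>

lemma L2_add:
  fixes u v :: "'a::euclidean_space \<Rightarrow> 'b::euclidean_space"
  assumes "u \<in> L2 \<Omega>" "v \<in> L2 \<Omega>"
  shows "(\<lambda>x. u x + v x) \<in> L2 \<Omega>"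
proof -
  have [measurable]: "u \<in> borel_measurable (lebesgue_on \<Omega>)" "v \<in> borel_measurable (lebesgue_on \<Omega>)"
    using assms by (auto simp: L2_def)
  have bound: "(norm (a + b))\<^sup>2 \<le> 2 * (norm a)\<^sup>2 + 2 * (norm b)\<^sup>2" for a b :: 'b
  proof -
    have "(norm (a + b))\<^sup>2 \<le> (norm a + norm b)\<^sup>2"
      by (intro power_mono norm_triangle_ineq) simp
    also have "\<dots> \<le> 2 * (norm a)\<^sup>2 + 2 * (norm b)\<^sup>2"
      using sum_squares_bound[of "norm a" "norm b"] by (simp add: power2_sum)
    finally show ?thesis .
  qed
  have "integrable (lebesgue_on \<Omega>) (\<lambda>x. 2 * (norm (u x))\<^sup>2 + 2 * (norm (v x))\<^sup>2)"
    using assms by (auto simp: L2_def)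
  then have "integrable (lebesgue_on \<Omega>) (\<lambda>x. (norm (u x + v x))\<^sup>2)"
    by (rule Bochner_Integration.integrable_bound) (auto intro: bound)
  then show ?thesis by (simp add: L2_def)
qed

lemma L2_scaleR:
  assumes "u \<in> L2 \<Omega>"
  shows "(\<lambda>x. r *\<^sub>R u x) \<in> L2 \<Omega>"
  using assms by (auto simp: L2_def power_mult_distrib)

lemma L2_const:
  assumes "\<Omega> \<in> lmeasurable"
  shows "(\<lambda>x. v) \<in> L2 \<Omega>"
proof -
  interpret finite_measure "lebesgue_on \<Omega>" by (rule finite_measure_lebesgue_on[OF assms])
  show ?thesis by (simp add: L2_def)
qed

lemma L2_norm_scaleR: "L2_norm \<Omega> (\<lambda>x. r *\<^sub>R u x) = \<bar>r\<bar> * L2_norm \<Omega> u"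
  by (simp add: L2_norm_def power_mult_distrib real_sqrt_mult)

lemma L2_norm_nonneg: "L2_norm \<Omega> u \<ge> 0"
  by (simp add: L2_norm_def)

text \<open>
  Along a ray the increment of \<open>S\<close> is at most linear: the derivative contributes its operator bound
  and the remainder, with tolerance \<open>1\<close>, one further multiple of the norm of the direction.
\<close>
lemma frechet_derivative_linear_bound:
  assumes "L2_has_frechet_derivative \<Omega> S D u" "h \<in> L2 \<Omega>"
  obtains L d where "d > 0"
    "\<And>t. 0 \<le> t \<Longrightarrow> t < d \<Longrightarrow> norm (S (\<lambda>x. u x + t *\<^sub>R h x) - S u) \<le> L * t"
proof -
  obtain K where K: "\<And>k. k \<in> L2 \<Omega> \<Longrightarrow> norm (D k) \<le> K * L2_norm \<Omega> k"
    using assms(1) unfolding L2_has_frechet_derivative_def L2_bounded_linear_def by blast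
  have "\<forall>e>0. \<exists>d>0. \<forall>h\<in>L2 \<Omega>. L2_norm \<Omega> h < d \<longrightarrow>
      norm (S (\<lambda>x. u x + h x) - S u - D h) \<le> e * L2_norm \<Omega> h"
    using assms(1) unfolding L2_has_frechet_derivative_def by blast
  from this[rule_format, of 1] obtain d where d: "d > 0" "\<And>k. k \<in> L2 \<Omega> \<Longrightarrow> L2_norm \<Omega> k < d \<Longrightarrow>
      norm (S (\<lambda>x. u x + k x) - S u - D k) \<le> L2_norm \<Omega> k"
    by auto
  let ?N = "L2_norm \<Omega> h"
  have N: "?N \<ge> 0" by (rule L2_norm_nonneg)
  show thesis
    \<comment> \<open>Adding \<open>1\<close> to \<open>?N\<close> keeps the quotient meaningful for a direction of norm zero.\<close>
  proof (rule that[of "d / (?N + 1)" "(K + 1) * ?N"])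
    show "d / (?N + 1) > 0" using d(1) N by simp
    fix t assume t: "0 \<le> t" "t < d / (?N + 1)"
    let ?k = "\<lambda>x. t *\<^sub>R h x"
    have k: "?k \<in> L2 \<Omega>" using assms(2) by (rule L2_scaleR)
    have n: "L2_norm \<Omega> ?k = t * ?N" using t by (simp add: L2_norm_scaleR)
    have "t * (?N + 1) < d" using t N by (simp add: field_simps)
    moreover have "t * ?N \<le> t * (?N + 1)" using t by (simp add: algebra_simps)
    ultimately have "L2_norm \<Omega> ?k < d" using n by simp
    from d(2)[OF k this] K[OF k] norm_triangle_ineq[of "S (\<lambda>x. u x + ?k x) - S u - D ?k" "D ?k"]
    show "norm (S (\<lambda>x. u x + ?k x) - S u) \<le> (K + 1) * ?N * t"
      by (simp add: n algebra_simps)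
  qed
qed

section \<open>First-order comparison along a segment\<close>

text \<open>
  Cancel \<open>(1 - t) * a\<close>, divide by \<open>t\<close>, and let \<open>t\<close> tend to \<open>0\<close>. Here \<open>a\<close> is the penalty of the
  minimizer, \<open>b\<close> that of the constant competitor, and \<open>L * t\<^sup>2\<close> the cost of the tracking term.
\<close>
lemma le_if_linear_gain_le_quadratic:
  fixes a b L d :: real
  assumes "d > 0" and "\<And>t. 0 < t \<Longrightarrow> t < d \<Longrightarrow> a \<le> L * t\<^sup>2 + (1 - t) * a + t * b"
  shows "a \<le> b"
proof (rule tendsto_lowerbound)
  show "((\<lambda>t. L * t + b) \<longlongrightarrow> b) (at_right 0)"
    by (auto intro!: tendsto_eq_intros)
  have "a \<le> L * t + b" if "0 < t" "t < d" for t
  proof -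
    have "t * a \<le> t * (L * t + b)"
      using assms(2)[OF that] by (simp add: algebra_simps power2_eq_square)
    then show ?thesis using that by simp
  qed
  then show "\<forall>\<^sub>F t in at_right 0. a \<le> L * t + b"
    using assms(1) by (auto simp: eventually_at_right_field)
qed simp

text \<open>
  The right-hand side is kept as one real number so that minimality becomes a real inequality, in
  which \<open>I\<close>, the finite penalty of \<open>u\<close>, can be cancelled.
\<close>
lemma objective_along_segment:
  fixes S :: "('a::euclidean_space \<Rightarrow> 'b::euclidean_space) \<Rightarrow> 'y::real_normed_vector"
    and g :: "'b \<Rightarrow> ereal"
  assumes \<Omega>: "\<Omega> \<in> lmeasurable" and u: "u \<in> L2 \<Omega>"
    and g: "g \<in> borel_measurable borel" and g0: "\<And>v. 0 \<le> g v" and w: "g w = ereal \<mu>"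
    and conv: "\<And>v t. 0 \<le> t \<Longrightarrow> t \<le> 1 \<Longrightarrow>
      g ((1 - t) *\<^sub>R v + t *\<^sub>R w) \<le> ereal (1 - t) * g v + ereal t * g w"
    and fin: "(\<integral>\<^sup>+x. e2ennreal (g (u x)) \<partial>lebesgue_on \<Omega>) = ennreal I" "0 \<le> I"
    and t: "0 \<le> t" "t \<le> 1"
    and S: "norm (S (\<lambda>x. u x + t *\<^sub>R (w - u x)) - z) \<le> L * t"
  shows "objective \<Omega> S g z (\<lambda>x. u x + t *\<^sub>R (w - u x))
    \<le> ennreal (L\<^sup>2 / 2 * t\<^sup>2 + (1 - t) * I + t * (\<mu> * measure lebesgue \<Omega>))"
proof -
  have [measurable]: "u \<in> borel_measurable (lebesgue_on \<Omega>)" using u by (simp add: L2_def)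
  note [measurable] = g
  have \<mu>: "0 \<le> \<mu>" using g0[of w] w by simp
  have pw: "e2ennreal (g (v + t *\<^sub>R (w - v))) \<le> ennreal (1 - t) * e2ennreal (g v) + ennreal (t * \<mu>)" for v
  proof -
    \<comment> \<open>Convexity holds in the extended reals; the value \<open>\<infinity>\<close> needs care at \<open>t = 1\<close>, where its weight is \<open>0\<close>.\<close>
    have "g (v + t *\<^sub>R (w - v)) \<le> ereal (1 - t) * g v + ereal (t * \<mu>)"
      using conv[OF t, of v] w by (simp add: algebra_simps)
    then have "e2ennreal (g (v + t *\<^sub>R (w - v))) \<le> e2ennreal (ereal (1 - t) * g v + ereal (t * \<mu>))"
      by (rule e2ennreal_mono)
    also have "\<dots> = ennreal (1 - t) * e2ennreal (g v) + ennreal (t * \<mu>)"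
    proof (cases "g v")
      case (real r)
      then show ?thesis using t \<mu> g0[of v] by (simp add: ennreal_mult ennreal_plus)
    next
      case PInf
      then show ?thesis using t
        by (cases "t = 1") (auto simp: infinity_ereal_def[symmetric] e2ennreal_infty ennreal_mult_top)
    qed (use g0[of v] in auto)
    finally show ?thesis .
  qed
  have em: "emeasure (lebesgue_on \<Omega>) \<Omega> = ennreal (measure lebesgue \<Omega>)"
    using \<Omega> by (simp add: emeasure_restrict_space emeasure_eq_measure2 fmeasurableD)
  have "(\<integral>\<^sup>+x. e2ennreal (g (u x + t *\<^sub>R (w - u x))) \<partial>lebesgue_on \<Omega>)
    \<le> (\<integral>\<^sup>+x. ennreal (1 - t) * e2ennreal (g (u x)) + ennreal (t * \<mu>) \<partial>lebesgue_on \<Omega>)"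
    by (intro nn_integral_mono pw)
  also have "\<dots> = ennreal (1 - t) * ennreal I + ennreal (t * \<mu>) * ennreal (measure lebesgue \<Omega>)"
    by (simp add: nn_integral_add nn_integral_cmult fin em)
  also have "\<dots> = ennreal ((1 - t) * I + t * (\<mu> * measure lebesgue \<Omega>))"
    using t \<mu> fin by (simp add: ennreal_mult ennreal_plus mult.assoc)
  finally have int: "(\<integral>\<^sup>+x. e2ennreal (g (u x + t *\<^sub>R (w - u x))) \<partial>lebesgue_on \<Omega>)
    \<le> ennreal ((1 - t) * I + t * (\<mu> * measure lebesgue \<Omega>))" .
  have "(norm (S (\<lambda>x. u x + t *\<^sub>R (w - u x)) - z))\<^sup>2 \<le> (L * t)\<^sup>2"
    using S by (intro power_mono) auto
  then have "objective \<Omega> S g z (\<lambda>x. u x + t *\<^sub>R (w - u x))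
      \<le> ennreal (L\<^sup>2 / 2 * t\<^sup>2) + ennreal ((1 - t) * I + t * (\<mu> * measure lebesgue \<Omega>))"
    unfolding objective_def by (intro add_mono int ennreal_leI) (simp add: power_mult_distrib)
  also have "\<dots> = ennreal (L\<^sup>2 / 2 * t\<^sup>2 + (1 - t) * I + t * (\<mu> * measure lebesgue \<Omega>))"
    using t \<mu> fin by (subst ennreal_plus[symmetric]) (auto simp: add.assoc)
  finally show ?thesis .
qed

lemma AE_eq_lower_bound_if_nn_integral_le:
  fixes f :: "'a \<Rightarrow> ennreal"
  assumes "f \<in> borel_measurable N" "\<And>x. k \<le> f x"
    and "(\<integral>\<^sup>+x. f x \<partial>N) \<le> k * emeasure N (space N)" "k * emeasure N (space N) < \<infinity>"
  shows "AE x in N. f x = k"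
proof -
  note [measurable] = assms(1)
  have "(\<integral>\<^sup>+x. f x - k \<partial>N) = (\<integral>\<^sup>+x. f x \<partial>N) - (\<integral>\<^sup>+x. k \<partial>N)"
    using assms by (intro nn_integral_diff) auto
  also have "\<dots> = 0"
    using assms(3,4) by (simp add: diff_eq_0_iff_ennreal top.not_eq_extremum order.strict_trans1)
  finally have "AE x in N. f x - k = 0"
    by (subst (asm) nn_integral_0_iff_AE) auto
  then show ?thesis
    by eventually_elim (use assms(2) in \<open>auto simp: diff_eq_0_iff_ennreal intro: antisym\<close>)
qed

text \<open>
  Minimality is tested along the segment from \<open>u\<close> to the constant control \<open>w\<close>. The residual of \<open>u\<close>
  vanishes, so near \<open>u\<close> the tracking term is of second order in the step, whereas the penalty gains
  at first order unless \<open>g(u)\<close> already equals its lower bound almost everywhere.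
\<close>
lemma exact_minimizer_attains_penalty_minimum:
  fixes S :: "('a::euclidean_space \<Rightarrow> 'b::euclidean_space) \<Rightarrow> 'y::real_normed_vector"
    and g :: "'b \<Rightarrow> ereal"
  assumes \<Omega>: "\<Omega> \<in> lmeasurable"
    and g: "g \<in> borel_measurable borel" and \<mu>: "0 \<le> \<mu>" "\<And>v. ereal \<mu> \<le> g v" "g w = ereal \<mu>"
    and conv: "\<And>v t. 0 \<le> t \<Longrightarrow> t \<le> 1 \<Longrightarrow>
      g ((1 - t) *\<^sub>R v + t *\<^sub>R w) \<le> ereal (1 - t) * g v + ereal t * g w"
    and D: "L2_has_frechet_derivative \<Omega> S D u"
    and min: "is_arg_min (objective \<Omega> S g z) (\<lambda>w. w \<in> L2 \<Omega>) u"
    and Su: "S u = z"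
  shows "AE x in lebesgue_on \<Omega>. g (u x) = ereal \<mu>"
proof -
  have u: "u \<in> L2 \<Omega>" using min by (simp add: is_arg_min_def)
  then have [measurable]: "u \<in> borel_measurable (lebesgue_on \<Omega>)" by (simp add: L2_def)
  note [measurable] = g
  have le: "objective \<Omega> S g z u \<le> objective \<Omega> S g z v" if "v \<in> L2 \<Omega>" for v
    using min that by (auto simp: is_arg_min_def not_less)
  have em: "emeasure (lebesgue_on \<Omega>) \<Omega> = ennreal (measure lebesgue \<Omega>)"
    using \<Omega> by (simp add: emeasure_restrict_space emeasure_eq_measure2 fmeasurableD)
  have obj_u: "objective \<Omega> S g z u = (\<integral>\<^sup>+x. e2ennreal (g (u x)) \<partial>lebesgue_on \<Omega>)"
    by (simp add: objective_def Su)
  \<comment> \<open>Comparison with the constant control \<open>w\<close> makes the penalty of \<open>u\<close> finite.\<close>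
  have "objective \<Omega> S g z u \<le> objective \<Omega> S g z (\<lambda>x. w)"
    by (rule le[OF L2_const[OF \<Omega>]])
  also have "\<dots> < \<infinity>"
    by (simp add: objective_def \<mu> em ennreal_mult_less_top)
  finally obtain I where I: "(\<integral>\<^sup>+x. e2ennreal (g (u x)) \<partial>lebesgue_on \<Omega>) = ennreal I" "0 \<le> I"
    unfolding obj_u by (auto simp: less_top_ennreal)
  let ?h = "\<lambda>x. w - u x"
  have h: "?h \<in> L2 \<Omega>"
    using L2_add[OF L2_const[OF \<Omega>] L2_scaleR[OF u, of "-1"]] by simp
  obtain L d where d: "d > 0"
    and L: "\<And>t. 0 \<le> t \<Longrightarrow> t < d \<Longrightarrow> norm (S (\<lambda>x. u x + t *\<^sub>R ?h x) - S u) \<le> L * t"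
    using frechet_derivative_linear_bound[OF D h] by blast
  have g0: "0 \<le> g v" for v using \<mu>(1,2) by (meson ereal_less_eq(5) order_trans)
  have "I \<le> \<mu> * measure lebesgue \<Omega>"
  proof (rule le_if_linear_gain_le_quadratic[of "min d 1" _ "L\<^sup>2 / 2"])
    fix t :: real assume t: "0 < t" "t < min d 1"
    have "ennreal I \<le> objective \<Omega> S g z (\<lambda>x. u x + t *\<^sub>R ?h x)"
      using le[OF L2_add[OF u L2_scaleR[OF h]]] by (simp add: obj_u I)
    also have "\<dots> \<le> ennreal (L\<^sup>2 / 2 * t\<^sup>2 + (1 - t) * I + t * (\<mu> * measure lebesgue \<Omega>))"
      using t L Su by (intro objective_along_segment \<Omega> u g g0 \<mu> conv I) auto
    finally show "I \<le> L\<^sup>2 / 2 * t\<^sup>2 + (1 - t) * I + t * (\<mu> * measure lebesgue \<Omega>)"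
      by (subst (asm) ennreal_le_iff) (use t I \<mu> in auto)
  qed (use d in simp)
  then have "(\<integral>\<^sup>+x. e2ennreal (g (u x)) \<partial>lebesgue_on \<Omega>)
      \<le> ennreal \<mu> * emeasure (lebesgue_on \<Omega>) (space (lebesgue_on \<Omega>))"
    using \<mu>(1) by (simp add: I em flip: ennreal_mult)
  moreover have "ennreal \<mu> \<le> e2ennreal (g v)" for v
    using e2ennreal_mono[OF \<mu>(2)] by simp
  ultimately have "AE x in lebesgue_on \<Omega>. e2ennreal (g (u x)) = ennreal \<mu>"
    by (intro AE_eq_lower_bound_if_nn_integral_le) (auto simp: em ennreal_mult_less_top)
  then show ?thesis
  proof eventually_elim
    case (elim x)
    \<comment> \<open>On non-negative values the truncation \<^const>\<open>e2ennreal\<close> is injective.\<close>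
    then have "enn2ereal (e2ennreal (g (u x))) = enn2ereal (ennreal \<mu>)" by simp
    then show ?case using g0 \<mu>(1) by (simp add: enn2ereal_e2ennreal)
  qed
qed

section \<open>Minimizers with exact data\<close>

theorem proposition3p8:
  fixes \<Omega> :: "(real ^ 'n) set"
    and S :: "(real ^ 'n \<Rightarrow> real ^ 'm) \<Rightarrow> 'y::{real_inner, complete_space}"
    and M :: "(real ^ 'm) set"
    and \<alpha> :: real
    and c :: "real ^ 'm \<Rightarrow> real"
    and g :: "real ^ 'm \<Rightarrow> ereal"
    and z :: 'y
    and u :: "real ^ 'n \<Rightarrow> real ^ 'm"
  assumes "open \<Omega>" and "connected \<Omega>" and "\<Omega> \<noteq> {}" and "bounded \<Omega>"
    and "CARD('m) \<ge> 2"
    and "finite M" and "M \<noteq> {}"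
    and "\<alpha> > 0"
    and "\<And>v. c v \<ge> 0" and "strictly_convex c" and "lower_semicontinuous c"
    and "g = multibang_penalty \<alpha> c M"
    and "respects_ae \<Omega> S"
    and "L2_frechet_differentiable \<Omega> S"
    and "is_arg_min (objective \<Omega> S g z) (\<lambda>w. w \<in> L2 \<Omega>) u"
    and "S u = z"
  shows "(AE x in lebesgue_on \<Omega>. g (u x) = Min (g ` M)) \<and>
    ((AE x in lebesgue_on \<Omega>. u x \<in> M) \<longrightarrow>
     (AE x in lebesgue_on \<Omega>. c (u x) = Min (c ` M)))"
proof -
  note fM = \<open>finite M\<close> and neM = \<open>M \<noteq> {}\<close> and g = \<open>g = multibang_penalty \<alpha> c M\<close>
  define \<mu> where "\<mu> = Min ((\<lambda>w. \<alpha> * c w) ` M)"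
  have "\<mu> \<in> (\<lambda>w. \<alpha> * c w) ` M"
    unfolding \<mu>_def using fM neM by (intro Min_in) auto
  then obtain w where w: "w \<in> M" "\<mu> = \<alpha> * c w" by auto
  have \<mu>: "0 \<le> \<mu>" "ereal \<mu> \<le> g v" "g w = ereal \<mu>" for v
    unfolding g
  proof -
    show "0 \<le> \<mu>" using w \<open>\<alpha> > 0\<close> \<open>\<And>v. c v \<ge> 0\<close> by simp
    show "ereal \<mu> \<le> multibang_penalty \<alpha> c M v"
      unfolding \<mu>_def by (rule multibang_penalty_ge_Min[OF fM neM])
    show "multibang_penalty \<alpha> c M w = ereal \<mu>"
      unfolding \<mu>_def by (rule multibang_penalty_at_Min[OF fM w(1)]) (use w \<mu>_def in simp)
  qed
  have Min_g: "Min (g ` M) = ereal \<mu>"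
    using fM w(1) \<mu> by (intro Min_eqI) (auto intro: rev_image_eqI)
  have Min_c: "Min (c ` M) = c w"
  proof (rule Min_eqI)
    fix y assume "y \<in> c ` M"
    then obtain v where v: "v \<in> M" "y = c v" by auto
    then have "\<mu> \<le> \<alpha> * c v" unfolding \<mu>_def using fM by (intro Min_le) auto
    then show "c w \<le> y" using w v \<open>\<alpha> > 0\<close> by simp
  qed (use fM w in auto)
  have g_SUP: "g = (\<lambda>v. SUP p. ereal (p \<bullet> v - Max ((\<lambda>w. p \<bullet> w - \<alpha> * c w) ` M)))"
    unfolding g using multibang_penalty_eq_SUP[OF fM neM] by (intro ext)
  have \<Omega>: "\<Omega> \<in> lmeasurable"
    using \<open>open \<Omega>\<close> \<open>bounded \<Omega>\<close> by (rule lmeasurable_open[rotated])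
  have "u \<in> L2 \<Omega>" using assms(15) by (simp add: is_arg_min_def)
  then obtain D where D: "L2_has_frechet_derivative \<Omega> S D u"
    using \<open>L2_frechet_differentiable \<Omega> S\<close> by (auto simp: L2_frechet_differentiable_def)
  have AE_g: "AE x in lebesgue_on \<Omega>. g (u x) = ereal \<mu>"
  proof (rule exact_minimizer_attains_penalty_minimum[OF \<Omega> _ \<mu> _ D assms(15,16)])
    show "g \<in> borel_measurable borel"
      unfolding g_SUP by (rule borel_measurable_SUP_affine)
    show "g ((1 - t) *\<^sub>R v + t *\<^sub>R w) \<le> ereal (1 - t) * g v + ereal t * g w"
      if "0 \<le> t" "t \<le> 1" for v t
      unfolding g_SUP using that by (rule SUP_affine_convex)
  qed
  have cv: "convex_on UNIV (\<lambda>w. \<alpha> * c w)"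
    using strictly_convex_imp_convex_on[OF \<open>strictly_convex c\<close>] \<open>\<alpha> > 0\<close>
    by (intro convex_on_cmul) auto
  have "AE x in lebesgue_on \<Omega>. c (u x) = c w" if "AE x in lebesgue_on \<Omega>. u x \<in> M"
    using AE_g that
  proof eventually_elim
    case (elim x)
    then have "\<alpha> * c (u x) = \<alpha> * c w"
      using multibang_penalty_eq_on_set[OF fM _ cv, of "u x"] by (simp add: g w)
    then show ?case using \<open>\<alpha> > 0\<close> by simp
  qed
  with AE_g show ?thesis by (simp add: Min_g Min_c)
qed

end
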